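(* Let $0<q<\infty$ and let $I=(f_1,\ldots,f_n)$ be a finitely generated ideal in $H^\infty$. Assume that $I$ contains a zero-free holomorphic function $F$ on $D$ such that $\log F\in H^q$. Then for every interpolating sequence $\{z_k\}_{k\ge1}\subset D$, $$\sum_{k=1}^\infty\big(1-|z_k|^2\big)\Big|\log\big(|f_1(z_k)|+\cdots+|f_n(z_k)|\big)\Big|^q<\infty.$$
   Context: $D$ is the open unit disk in $\mathbb{C}$. $H^\infty$ is the ring of bounded holomorphic functions on $D$; $(f_1,\ldots,f_n)=\{\sum_{i=1}^n g_if_i: g_i\in H^\infty\}$ is the ideal of $H^\infty$ generated by $f_1,\ldots,f_n\in H^\infty$. For $0<q<\infty$, $H^q$ is the Hardy space of holomorphic $f$ on $D$ with $\sup_{0<r<1}\int_0^{2\pi}|f(re^{i\theta})|^q\,\frac{d\theta}{2\pi}<\infty$. $\log F$ denotes a holomorphic branch of the logarithm of $F$ on $D$. A sequence $\{z_k\}\subset D$ is an interpolating sequence (for $H^\infty$) if for every bounded sequence $\{\omega_k\}$ of complex numbers there exists $f\in H^\infty$ with $f(z_k)=\omega_k$ for every $k$. *)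

theory Defs
  imports "HOL-Complex_Analysis.Complex_Analysis"
begin

abbreviation unit_disc :: "complex set" where
  "unit_disc \<equiv> ball 0 1"

text \<open>Functions on the disc are total functions on \<^typ>\<open>complex\<close> whose values off the disc are
  irrelevant: every notion below depends only on the restriction to the disc.\<close>

definition Hinf :: "(complex \<Rightarrow> complex) set" where
  "Hinf = {f. f holomorphic_on unit_disc \<and> bounded (f ` unit_disc)}"

definition Hinf_ideal :: "nat \<Rightarrow> (nat \<Rightarrow> complex \<Rightarrow> complex) \<Rightarrow> (complex \<Rightarrow> complex) set" where
  "Hinf_ideal n f =
     {h. \<exists>g. (\<forall>i\<in>{1..n}. g i \<in> Hinf) \<and> (\<forall>z\<in>unit_disc. h z = (\<Sum>i=1..n. g i z * f i z))}"

text \<open>For \<open>q > 0\<close> the integrand is continuous, so the integral always exists and finiteness of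
  the supremum is boundedness of the integral means.\<close>

definition hardy_space :: "real \<Rightarrow> (complex \<Rightarrow> complex) set" where
  "hardy_space q =
     {f. f holomorphic_on unit_disc \<and>
         bdd_above ((\<lambda>r. integral {0..2*pi}
            (\<lambda>\<theta>. norm (f (of_real r * cis \<theta>)) powr q / (2*pi))) ` {0<..<1})}"

definition log_branch :: "(complex \<Rightarrow> complex) \<Rightarrow> (complex \<Rightarrow> complex) \<Rightarrow> bool" where
  "log_branch F L \<longleftrightarrow> L holomorphic_on unit_disc \<and> (\<forall>z\<in>unit_disc. exp (L z) = F z)"

definition interpolating_sequence :: "(nat \<Rightarrow> complex) \<Rightarrow> bool" where
  "interpolating_sequence z \<longleftrightarrow>
     (\<forall>k. z k \<in> unit_disc) \<and>
     (\<forall>\<omega>::nat \<Rightarrow> complex. bounded (range \<omega>) \<longrightarrow> (\<exists>f\<in>Hinf. \<forall>k. f (z k) = \<omega> k))"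

end

theory Submission
  imports Defs
begin

text \<open>
  The logarithm in the sum is controlled by \<open>L = log F\<close>. Writing \<open>F = \<Sum> g\<^sub>i f\<^sub>i\<close> with bounded
  \<open>g\<^sub>i\<close> gives \<open>\<bar>F\<bar> \<le> C' \<Sum> \<bar>f\<^sub>i\<bar>\<close>, while \<open>\<Sum> \<bar>f\<^sub>i\<bar>\<close> is bounded above; hence
  \<open>\<bar>log \<Sum> \<bar>f\<^sub>i\<bar>\<bar> \<le> C + \<bar>L\<bar>\<close> (\<open>abs_ln_sum_norm_le\<close>). What is left is the Carleson embedding
  \<open>\<Sum> (1 - \<bar>z\<^sub>k\<bar>\<^sup>2) \<bar>L(z\<^sub>k)\<bar>\<^sup>q < \<infinity>\<close>, up to additive constants in \<open>L\<close>.

  The exponent \<open>q\<close> reduces to \<open>1\<close> without any factorization theory of Hardy spaces. Since \<open>F\<close> is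
  bounded, \<open>Re L\<close> is bounded above, so for a large constant \<open>c\<close> the function \<open>h = c - L\<close> has real
  part at least \<open>1\<close>. It therefore has a holomorphic power \<open>G = h\<^sup>q\<close>, and \<open>\<bar>G\<bar> = \<bar>h\<bar>\<^sup>q\<close> puts \<open>G\<close> into
  \<open>H\<^sup>1\<close> (\<open>hardy_space_const_minus\<close>, \<open>hardy_space_power_right_half_plane\<close>). The bound
  \<open>\<bar>h\<bar> \<ge> 1\<close> also absorbs the additive constants.

  For \<open>q = 1\<close> the embedding (\<open>interpolating_sequence_carleson_embedding\<close>) is a duality argument. If
  \<open>B\<close> is the finite Blaschke product with zeros at the points \<open>u\<close> of a finite set \<open>S\<close>, then the
  residue theorem yields
  \<open>\<Sum>\<^bsub>u \<in> S\<^esub> f(u) G(u) / B'(u) = (1 / 2\<pi>\<i>) \<integral> f G / B dz\<close> over the unit circle, where \<open>\<bar>B\<bar> = 1\<close>, and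
  \<open>1 / \<bar>B'(u)\<bar> \<ge> 1 - \<bar>u\<bar>\<^sup>2\<close>. If \<open>f\<close> is bounded by \<open>M\<close> and its values on \<open>S\<close> are the phases that make
  every term on the left nonnegative, then \<open>\<Sum> (1 - \<bar>u\<bar>\<^sup>2) \<bar>G(u)\<bar>\<close> is at most \<open>M\<close> times the mean of
  \<open>\<bar>G\<bar>\<close>. Functions on the open disc are first dilated to radius \<open>r < 1\<close>, and then \<open>r\<close> tends to \<open>1\<close>.

  The constant \<open>M\<close> must not depend on \<open>S\<close>. A gliding hump argument gives such a constant for all
  finite pieces of some tail of the sequence (\<open>interpolating_sequence_uniform_tail\<close>), and a tail
  suffices for summability.
\<close>

section \<open>Residues against a finite Blaschke product\<close>

text \<open>This identity compares the numerator and the denominator of a Blaschke factor, inside the disc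
  and on its boundary.\<close>

lemma norm_one_minus_cnj_mult:
  "norm (1 - cnj w * z) ^ 2 = norm (z - w) ^ 2 + (1 - norm z ^ 2) * (1 - norm w ^ 2)"
  unfolding cmod_power2 by (simp add: power2_eq_square algebra_simps)

text \<open>The reciprocal of the Blaschke factor with zero \<open>w\<close>. Unlike the factor itself it is holomorphic
  on the whole plane apart from \<open>w\<close>, so larger discs may contain the reflected point \<open>1 / cnj w\<close>.\<close>

definition blaschke_recip :: "complex \<Rightarrow> complex \<Rightarrow> complex" where
  "blaschke_recip w z = (1 - cnj w * z) / (z - w)"

lemma norm_blaschke_recip_ge_1:
  assumes "norm w < 1" "norm z < 1" "z \<noteq> w"
  shows "norm (blaschke_recip w z) \<ge> 1"
proof -
  have "(1 - norm z ^ 2) * (1 - norm w ^ 2) \<ge> 0"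
    using assms by (intro mult_nonneg_nonneg) (auto simp: power_le_one)
  then have "norm (z - w) ^ 2 \<le> norm (1 - cnj w * z) ^ 2"
    by (simp add: norm_one_minus_cnj_mult)
  then have "norm (z - w) \<le> norm (1 - cnj w * z)"
    by (rule power2_le_imp_le) simp
  then show ?thesis
    using assms by (simp add: blaschke_recip_def norm_divide)
qed

lemma norm_blaschke_recip_eq_1:
  assumes "norm w < 1" "norm z = 1"
  shows "norm (blaschke_recip w z) = 1"
proof -
  have "norm (1 - cnj w * z) = norm (z - w)"
    using norm_one_minus_cnj_mult[of w z] assms by simp
  moreover have "z \<noteq> w"
    using assms by auto
  ultimately show ?thesis
    by (simp add: blaschke_recip_def norm_divide)
qed

text \<open>All poles of the integrand are simple, and the one at \<open>u\<close> comes from the single factor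
  \<open>(1 - cnj u * z) / (z - u)\<close>, whose numerator at \<open>u\<close> is \<open>1 - \<bar>u\<bar>\<^sup>2\<close>. This is where the Carleson
  weight enters.\<close>

lemma contour_integral_blaschke_recip:
  assumes "finite S" "S \<subseteq> unit_disc" "1 < R" and holo: "\<phi> holomorphic_on ball 0 R"
  shows "contour_integral (circlepath 0 1) (\<lambda>z. \<phi> z * (\<Prod>w\<in>S. blaschke_recip w z)) =
    2 * pi * \<i> * (\<Sum>u\<in>S. \<phi> u * of_real (1 - norm u ^ 2) * (\<Prod>w\<in>S - {u}. blaschke_recip w u))"
proof -
  let ?f = "\<lambda>z. \<phi> z * (\<Prod>w\<in>S. blaschke_recip w z)"
  have SR: "S \<subseteq> ball 0 R"
    using assms by (auto simp: subset_iff)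
  have "?f holomorphic_on ball 0 R - S"
    unfolding blaschke_recip_def
    by (intro holomorphic_intros holomorphic_on_subset[OF holo]) auto
  then have "contour_integral (circlepath 0 1) ?f =
      2 * pi * \<i> * (\<Sum>u\<in>S. winding_number (circlepath 0 1) u * residue ?f u)"
  proof (rule Residue_theorem[rotated 3])
    show "\<forall>u. u \<notin> ball 0 R \<longrightarrow> winding_number (circlepath 0 1) u = 0"
      using \<open>1 < R\<close>
      by (intro allI impI winding_number_zero_outside[where s = "cball 0 1"]) auto
  qed (use assms in \<open>auto simp: subset_iff\<close>)
  also have "(\<Sum>u\<in>S. winding_number (circlepath 0 1) u * residue ?f u) =
      (\<Sum>u\<in>S. \<phi> u * of_real (1 - norm u ^ 2) * (\<Prod>w\<in>S - {u}. blaschke_recip w u))"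
  proof (rule sum.cong[OF refl])
    fix u assume u: "u \<in> S"
    let ?g = "\<lambda>z. \<phi> z * (1 - cnj u * z) * (\<Prod>w\<in>S - {u}. blaschke_recip w z)"
    have f_eq: "?f = (\<lambda>z. ?g z / (z - u))"
      using u assms(1) by (auto simp: fun_eq_iff prod.remove[of S u] blaschke_recip_def)
    have "residue ?f u = ?g u"
      unfolding f_eq
    proof (rule residue_simple)
      show "open (ball 0 R - (S - {u}))"
        using assms(1) by (intro open_Diff open_ball finite_imp_closed) auto
      show "u \<in> ball 0 R - (S - {u})"
        using u SR by auto
      show "?g holomorphic_on ball 0 R - (S - {u})"
        unfolding blaschke_recip_def
        by (intro holomorphic_intros holomorphic_on_subset[OF holo]) auto
    qed
    moreover have "winding_number (circlepath 0 1) u = 1"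
      using u assms(2) by (intro winding_number_circlepath) auto
    moreover have "1 - cnj u * u = of_real (1 - norm u ^ 2)"
      by (metis complex_norm_square mult.commute of_real_1 of_real_diff)
    ultimately show "winding_number (circlepath 0 1) u * residue ?f u =
        \<phi> u * of_real (1 - norm u ^ 2) * (\<Prod>w\<in>S - {u}. blaschke_recip w u)"
      by simp
  qed
  finally show ?thesis .
qed

section \<open>Interpolation bounds weighted point sums by integral means\<close>

text \<open>The duality step: \<open>f\<close> interpolates the conjugate phase of \<open>G(u)\<close> times the other reciprocal
  factors at \<open>u\<close>. The residue sum of \<open>f G / B\<close> then has nonnegative terms, each at least
  \<open>(1 - \<bar>u\<bar>\<^sup>2) \<bar>G(u)\<bar>\<close> because the reciprocal factors have modulus at least \<open>1\<close> in the disc,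
  whereas on the circle they have modulus \<open>1\<close> and drop out of the integral.\<close>

lemma sum_le_circle_mean_of_interpolation:
  assumes S: "finite S" "S \<subseteq> unit_disc" and "1 < R" and G: "G holomorphic_on ball 0 R"
    and interp: "\<And>\<omega>. (\<And>w. norm (\<omega> w) \<le> 1) \<Longrightarrow>
      \<exists>f. f holomorphic_on ball 0 R \<and> (\<forall>w\<in>ball 0 R. norm (f w) \<le> M) \<and> (\<forall>w\<in>S. f w = \<omega> w)"
  shows "(\<Sum>u\<in>S. (1 - norm u ^ 2) * norm (G u)) \<le>
    M * integral {0..2*pi} (\<lambda>\<theta>. norm (G (cis \<theta>)) / (2*pi))"
proof -
  let ?P = "\<lambda>u. \<Prod>w\<in>S - {u}. blaschke_recip w u"
  let ?B = "\<lambda>z. \<Prod>w\<in>S. blaschke_recip w z"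
  obtain f where f: "f holomorphic_on ball 0 R"
      "\<And>w. w \<in> ball 0 R \<Longrightarrow> norm (f w) \<le> M" "\<And>u. u \<in> S \<Longrightarrow> f u = cnj (sgn (G u * ?P u))"
  proof -
    have "\<And>u. norm (cnj (sgn (G u * ?P u))) \<le> 1"
      by (simp add: norm_sgn)
    from interp[of "\<lambda>u. cnj (sgn (G u * ?P u))", OF this] that show ?thesis
      by blast
  qed
  have circle: "cis \<theta> \<in> ball 0 R" for \<theta>
    using \<open>1 < R\<close> by simp
  have nz: "cis \<theta> - w \<noteq> 0" if "w \<in> S" for w \<theta>
    using that S by (auto simp: subset_iff)
  have contG: "continuous_on UNIV (\<lambda>\<theta>. G (cis \<theta>))"
    by (rule continuous_on_compose2[OF holomorphic_on_imp_continuous_on[OF G]])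
       (use circle in \<open>auto intro!: continuous_intros\<close>)
  have contf: "continuous_on UNIV (\<lambda>\<theta>. f (cis \<theta>))"
    by (rule continuous_on_compose2[OF holomorphic_on_imp_continuous_on[OF f(1)]])
       (use circle in \<open>auto intro!: continuous_intros\<close>)
  let ?h = "\<lambda>\<theta>. f (cis \<theta>) * G (cis \<theta>) * ?B (cis \<theta>) * \<i> * cis \<theta>"
  have conth: "continuous_on {0..2*pi} ?h"
    unfolding blaschke_recip_def
    by (intro continuous_intros continuous_on_subset[OF contG] continuous_on_subset[OF contf])
       (use nz in auto)
  have norm_h: "norm (?h \<theta>) \<le> M * norm (G (cis \<theta>))" for \<theta>
  proof -
    have "norm (?B (cis \<theta>)) = 1"
      unfolding prod_norm[symmetric]
      by (intro prod.neutral ballI norm_blaschke_recip_eq_1) (use S in auto)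
    then show ?thesis
      using f(2)[OF circle[of \<theta>]] by (simp add: norm_mult mult_right_mono)
  qed
  have term_le: "(1 - norm u ^ 2) * norm (G u) \<le> Re (f u * G u * of_real (1 - norm u ^ 2) * ?P u)"
    if u: "u \<in> S" for u
  proof -
    have "1 \<le> norm (?P u)"
      unfolding prod_norm[symmetric]
      by (intro prod_ge_1 norm_blaschke_recip_ge_1) (use S u in auto)
    moreover have "f u * G u * of_real (1 - norm u ^ 2) * ?P u =
        of_real ((1 - norm u ^ 2) * norm (G u) * norm (?P u))"
    proof -
      have "cnj (sgn x) * x = of_real (norm x)" for x :: complex
        by (cases "x = 0")
           (auto simp: sgn_eq complex_norm_square[symmetric] power2_eq_square mult.commute)
      from this[of "G u * ?P u"] show ?thesis
        using f(3)[OF u] by (simp add: norm_mult mult_ac)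
    qed
    moreover have "0 \<le> 1 - norm u ^ 2"
      using S u by (auto simp: subset_iff power_le_one)
    ultimately show ?thesis
      using mult_left_mono[of 1 "norm (?P u)" "(1 - norm u ^ 2) * norm (G u)"]
      by (simp del: of_real_mult of_real_diff)
  qed
  define \<Sigma> where "\<Sigma> = (\<Sum>u\<in>S. f u * G u * of_real (1 - norm u ^ 2) * ?P u)"
  have "(\<Sum>u\<in>S. (1 - norm u ^ 2) * norm (G u)) \<le> Re \<Sigma>"
    unfolding \<Sigma>_def Re_sum by (intro sum_mono term_le)
  also have "\<dots> \<le> norm \<Sigma>"
    by (rule complex_Re_le_cmod)
  also have "\<dots> = norm (integral {0..2*pi} ?h) / (2*pi)"
  proof -
    have "integral {0..2*pi} ?h =
        contour_integral (circlepath 0 1) (\<lambda>z. (f z * G z) * ?B z)"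
      unfolding circlepath_def by (subst contour_integral_part_circlepath_eq) auto
    also have "\<dots> = 2 * pi * \<i> * \<Sigma>"
      unfolding \<Sigma>_def
      by (intro contour_integral_blaschke_recip[OF S \<open>1 < R\<close>] holomorphic_intros f(1) G)
    finally show ?thesis
      by (simp add: norm_mult)
  qed
  also have "norm (integral {0..2*pi} ?h) \<le> integral {0..2*pi} (\<lambda>\<theta>. M * norm (G (cis \<theta>)))"
    by (intro integral_norm_bound_integral norm_h integrable_continuous_interval conth
          continuous_intros continuous_on_subset[OF contG]) auto
  finally show ?thesis
    by (simp add: divide_right_mono)
qed

text \<open>Dilation \<open>w \<mapsto> r w\<close> makes everything holomorphic past the unit circle. It replaces the points
  \<open>u\<close> by \<open>u / r\<close>, and the dilated interpolating functions solve the interpolation problem at these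
  new points with the same constant \<open>M\<close>; so the previous bound passes to the limit \<open>r \<rightarrow> 1\<close>.\<close>

lemma sum_le_of_integral_means_and_interpolation:
  assumes S: "finite S" "S \<subseteq> unit_disc" and G: "G holomorphic_on unit_disc"
    and mean: "\<And>r. 0 < r \<Longrightarrow> r < 1 \<Longrightarrow>
      integral {0..2*pi} (\<lambda>\<theta>. norm (G (of_real r * cis \<theta>)) / (2*pi)) \<le> K"
    and interp: "\<And>\<omega>. (\<And>w. norm (\<omega> w) \<le> 1) \<Longrightarrow>
      \<exists>f. f holomorphic_on unit_disc \<and> (\<forall>w\<in>unit_disc. norm (f w) \<le> M) \<and> (\<forall>w\<in>S. f w = \<omega> w)"
    and "0 \<le> M"
  shows "(\<Sum>u\<in>S. (1 - norm u ^ 2) * norm (G u)) \<le> M * K"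
proof -
  have dilated: "(\<Sum>u\<in>S. (1 - (norm u / r) ^ 2) * norm (G u)) \<le> M * K"
    if r: "0 < r" "r < 1" "\<And>u. u \<in> S \<Longrightarrow> norm u < r" for r :: real
  proof -
    let ?T = "(\<lambda>u. u / of_real r) ` S"
    have maps: "of_real r * w \<in> unit_disc" if "w \<in> ball 0 (1 / r)" for w :: complex
      using that r by (simp add: norm_mult field_simps)
    have holo: "(\<lambda>w. h (of_real r * w)) holomorphic_on ball 0 (1 / r)"
      if "h holomorphic_on unit_disc" for h
    proof -
      have "(\<lambda>w. of_real r * w) ` ball 0 (1 / r) \<subseteq> unit_disc"
        using maps by blast
      moreover have "(\<lambda>w. of_real r * w) holomorphic_on ball 0 (1 / r)"
        by (intro holomorphic_intros)
      ultimately show ?thesis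
        using holomorphic_on_compose_gen[OF _ that] unfolding o_def by blast
    qed
    have "(\<Sum>w\<in>?T. (1 - norm w ^ 2) * norm (G (of_real r * w)))
        \<le> M * integral {0..2*pi} (\<lambda>\<theta>. norm (G (of_real r * cis \<theta>)) / (2*pi))"
    proof (rule sum_le_circle_mean_of_interpolation[of _ "1 / r"])
      show "\<exists>f. f holomorphic_on ball 0 (1 / r) \<and> (\<forall>w\<in>ball 0 (1 / r). norm (f w) \<le> M) \<and>
          (\<forall>w\<in>?T. f w = \<omega> w)" if \<omega>: "\<And>w. norm (\<omega> w) \<le> 1" for \<omega>
      proof -
        obtain f where "f holomorphic_on unit_disc" "\<forall>w\<in>unit_disc. norm (f w) \<le> M"
            "\<forall>w\<in>S. f w = \<omega> (w / of_real r)"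
          using interp[of "\<lambda>w. \<omega> (w / of_real r)"] \<omega> by auto
        then show ?thesis
          using holo maps r by (intro exI[of _ "\<lambda>w. f (of_real r * w)"]) auto
      qed
      show "?T \<subseteq> unit_disc"
        using r by (auto simp: norm_divide)
    qed (use S r holo[OF G] in auto)
    also have "\<dots> \<le> M * K"
      by (intro mult_left_mono mean r \<open>0 \<le> M\<close>)
    also have "(\<Sum>w\<in>?T. (1 - norm w ^ 2) * norm (G (of_real r * w))) =
        (\<Sum>u\<in>S. (1 - (norm u / r) ^ 2) * norm (G u))"
      using r by (subst sum.reindex) (auto simp: inj_on_def norm_divide)
    finally show ?thesis .
  qed
  have "((\<lambda>r. \<Sum>u\<in>S. (1 - (norm u / r) ^ 2) * norm (G u)) \<longlongrightarrow>
      (\<Sum>u\<in>S. (1 - (norm u / 1) ^ 2) * norm (G u))) (at_left 1)"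
    by (intro tendsto_intros) auto
  moreover have "\<forall>\<^sub>F r in at_left (1::real).
      (\<Sum>u\<in>S. (1 - (norm u / r) ^ 2) * norm (G u)) \<le> M * K"
  proof -
    have "\<forall>\<^sub>F r in at_left (1::real). \<forall>u\<in>S. norm u < r"
      using S by (intro eventually_ball_finite ballI order_tendstoD(1)[OF tendsto_ident_at]) auto
    moreover have "\<forall>\<^sub>F r in at_left (1::real). r \<in> {0<..<1}"
      by (rule eventually_at_left_real) simp
    ultimately show ?thesis
      by eventually_elim (rule dilated, auto)
  qed
  ultimately have "(\<Sum>u\<in>S. (1 - (norm u / 1) ^ 2) * norm (G u)) \<le> M * K"
    by (rule tendsto_upperbound) simp
  then show ?thesis
    by simp
qed

section \<open>Interpolating sequences\<close>

text \<open>A gliding hump argument. If every tail and every constant \<open>m\<close> admitted a finite block of data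
  of modulus at most \<open>1\<close> that no function bounded by \<open>m\<close> interpolates, then bad blocks for
  \<open>m = 0, 1, 2, \<dots>\<close> could be placed one behind the other. The resulting bounded data would have no
  bounded interpolating function at all.\<close>

lemma interpolating_sequence_uniform_tail:
  assumes "interpolating_sequence z"
  obtains K :: nat and M :: real where "0 \<le> M"
    "\<And>N \<omega>. (\<And>k. norm (\<omega> k) \<le> 1) \<Longrightarrow>
      \<exists>f. f holomorphic_on unit_disc \<and> (\<forall>w\<in>unit_disc. norm (f w) \<le> M) \<and>
          (\<forall>k\<in>{K..<N}. f (z k) = \<omega> k)"
proof -
  define good where "good \<equiv> \<lambda>K N M \<omega>. \<exists>f. f holomorphic_on unit_disc \<and>
    (\<forall>w\<in>unit_disc. norm (f w) \<le> M) \<and> (\<forall>k\<in>{K..<N}. f (z k) = \<omega> k)"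
  have "\<exists>K m. \<forall>N \<omega>. (\<forall>k. norm (\<omega> k) \<le> 1) \<longrightarrow> good K N (real m) \<omega>"
  proof (rule ccontr)
    assume "\<not> ?thesis"
    then have "\<forall>K m. \<exists>N \<omega>. (\<forall>k. norm (\<omega> k) \<le> 1) \<and> \<not> good K N (real m) \<omega>"
      by blast
    then obtain N \<omega> where bad: "\<And>K m k. norm (\<omega> K m k) \<le> 1"
        "\<And>K m. \<not> good K (N K m) (real m) (\<omega> K m)"
      by metis
    \<comment> \<open>The \<open>m\<close>-th bad block lies in \<open>{a m..<a (Suc m)}\<close>; taking the maximum keeps \<open>a\<close> monotone even
      when a block is empty.\<close>
    define a where "a = rec_nat 0 (\<lambda>m K. max K (N K m))"
    have a_Suc: "a (Suc m) = max (a m) (N (a m) m)" for m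
      by (simp add: a_def)
    have "mono a"
      by (intro incseq_SucI) (simp add: a_Suc)
    define block where "block k = (LEAST m. k < a (Suc m))" for k
    have block: "block k = m" if "k \<in> {a m..<N (a m) m}" for k m
      unfolding block_def
    proof (rule Least_equality)
      show "k < a (Suc m)"
        using that by (simp add: a_Suc)
      show "m \<le> j" if "k < a (Suc j)" for j
        using monoD[OF \<open>mono a\<close>, of "Suc j" m] that \<open>k \<in> _\<close> by fastforce
    qed
    \<comment> \<open>Between two blocks the data are arbitrary values of modulus at most \<open>1\<close>.\<close>
    define \<Omega> where "\<Omega> k = \<omega> (a (block k)) (block k) k" for k
    have "bounded (range \<Omega>)"
      using bad(1) by (auto simp: \<Omega>_def bounded_iff)
    then obtain f where f: "f \<in> Hinf" "\<And>k. f (z k) = \<Omega> k"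
      using assms unfolding interpolating_sequence_def by blast
    then obtain B where "\<And>w. w \<in> unit_disc \<Longrightarrow> norm (f w) \<le> B"
      unfolding Hinf_def bounded_iff by blast
    moreover obtain m where "B \<le> real m"
      using real_arch_simple by blast
    ultimately have "good (a m) (N (a m) m) (real m) (\<omega> (a m) m)"
      unfolding good_def using f block
      by (intro exI[of _ f]) (fastforce simp: Hinf_def \<Omega>_def)
    then show False
      using bad(2) by blast
  qed
  then show ?thesis
    using that unfolding good_def by (metis of_nat_0_le_iff)
qed

lemma hardy_space_mean_bound:
  assumes "f \<in> hardy_space q"
  obtains A where "\<And>r. 0 < r \<Longrightarrow> r < 1 \<Longrightarrow>
    integral {0..2*pi} (\<lambda>\<theta>. norm (f (of_real r * cis \<theta>)) powr q / (2*pi)) \<le> A"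
  using assms that unfolding hardy_space_def bdd_above_def mem_Collect_eq ball_simps
  by (metis greaterThanLessThan_iff)

lemma interpolating_sequence_inj:
  assumes "interpolating_sequence z"
  shows "inj z"
proof (rule injI, rule ccontr)
  fix i j assume "z i = z j" "i \<noteq> j"
  have "bounded (range (\<lambda>k. if k = i then 1 else 0 :: complex))"
    by (auto simp: bounded_iff intro!: exI[of _ 1])
  then obtain f where "\<And>k. f (z k) = (if k = i then 1 else 0 :: complex)"
    using assms unfolding interpolating_sequence_def by blast
  from this[of i] this[of j] show False
    using \<open>z i = z j\<close> \<open>i \<noteq> j\<close> by simp
qed

text \<open>The embedding is proved for \<open>H\<^sup>1\<close> only: the uniform interpolation constant of a tail bounds its
  partial sums by a multiple of the supremum of the integral means.\<close>

theorem interpolating_sequence_carleson_embedding: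
  assumes z: "interpolating_sequence z" and G: "G \<in> hardy_space 1"
  shows "summable (\<lambda>k. (1 - norm (z k) ^ 2) * norm (G (z k)))"
proof -
  have holo: "G holomorphic_on unit_disc"
    using G by (simp add: hardy_space_def)
  obtain A where mean: "\<And>r. 0 < r \<Longrightarrow> r < 1 \<Longrightarrow>
      integral {0..2*pi} (\<lambda>\<theta>. norm (G (of_real r * cis \<theta>)) / (2*pi)) \<le> A"
    using hardy_space_mean_bound[OF G] by auto
  obtain K M where "0 \<le> M" and interp: "\<And>N \<omega>. (\<And>k. norm (\<omega> k) \<le> 1) \<Longrightarrow>
      \<exists>f. f holomorphic_on unit_disc \<and> (\<forall>w\<in>unit_disc. norm (f w) \<le> M) \<and>
          (\<forall>k\<in>{K..<N}. f (z k) = \<omega> k)"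
  proof (rule interpolating_sequence_uniform_tail[OF z])
    fix K and M :: real
    assume "0 \<le> M" "\<And>N \<omega>. (\<And>k. norm (\<omega> k) \<le> 1) \<Longrightarrow>
      \<exists>f. f holomorphic_on unit_disc \<and> (\<forall>w\<in>unit_disc. norm (f w) \<le> M) \<and>
          (\<forall>k\<in>{K..<N}. f (z k) = \<omega> k)"
    then show thesis
      by (rule that[of M K])
  qed
  have disc: "z k \<in> unit_disc" for k
    using z by (simp add: interpolating_sequence_def)
  have bound: "(\<Sum>k\<in>{K..<N}. (1 - norm (z k) ^ 2) * norm (G (z k))) \<le> M * A" for N
  proof -
    have "(\<Sum>u\<in>z ` {K..<N}. (1 - norm u ^ 2) * norm (G u)) \<le> M * A"
    proof (rule sum_le_of_integral_means_and_interpolation[OF _ _ holo mean _ \<open>0 \<le> M\<close>])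
      show "\<exists>f. f holomorphic_on unit_disc \<and> (\<forall>w\<in>unit_disc. norm (f w) \<le> M) \<and>
          (\<forall>w\<in>z ` {K..<N}. f w = \<omega> w)" if "\<And>w. norm (\<omega> w) \<le> 1" for \<omega>
        using interp[of "\<lambda>k. \<omega> (z k)" N] that by simp
    qed (use disc in auto)
    then show ?thesis
      using interpolating_sequence_inj[OF z] by (subst (asm) sum.reindex) (auto simp: inj_on_def)
  qed
  have "summable (\<lambda>k. (1 - norm (z (k + K)) ^ 2) * norm (G (z (k + K))))"
  proof (rule summableI_nonneg_bounded)
    show "0 \<le> (1 - norm (z (k + K)) ^ 2) * norm (G (z (k + K)))" for k
      using disc[of "k + K"] by (intro mult_nonneg_nonneg) (auto simp: power_le_one)
    show "(\<Sum>k<m. (1 - norm (z (k + K)) ^ 2) * norm (G (z (k + K)))) \<le> M * A" for m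
      using bound[of "m + K"]
        sum.shift_bounds_nat_ivl[of "\<lambda>k. (1 - norm (z k) ^ 2) * norm (G (z k))" 0 K m]
      by (simp add: atLeast0LessThan)
  qed
  then show ?thesis
    by (subst (asm) summable_iff_shift)
qed

section \<open>Translates and powers in Hardy spaces\<close>

text \<open>For \<open>q < 1\<close> the triangle inequality fails for the \<open>q\<close>-norm, but
  \<open>\<bar>c - y\<bar> \<le> 2 max \<bar>c\<bar> \<bar>y\<bar>\<close> gives a bound that works for all exponents at once.\<close>

lemma hardy_space_const_minus:
  assumes "0 < q" and L: "L \<in> hardy_space q"
  shows "(\<lambda>w. c - L w) \<in> hardy_space q"
proof -
  have holo: "L holomorphic_on unit_disc"
    using L by (simp add: hardy_space_def)
  obtain A where mean: "\<And>r. 0 < r \<Longrightarrow> r < 1 \<Longrightarrow>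
      integral {0..2*pi} (\<lambda>\<theta>. norm (L (of_real r * cis \<theta>)) powr q / (2*pi)) \<le> A"
    using hardy_space_mean_bound[OF L] by blast
  have "integral {0..2*pi} (\<lambda>\<theta>. norm (c - L (of_real r * cis \<theta>)) powr q / (2*pi))
      \<le> 2 powr q * (norm c powr q + A)" if r: "0 < r" "r < 1" for r :: real
  proof -
    have cont: "continuous_on {0..2*pi} (\<lambda>\<theta>. L (of_real r * cis \<theta>))"
      by (rule continuous_on_compose2[OF holomorphic_on_imp_continuous_on[OF holo]])
         (use r in \<open>auto intro!: continuous_intros simp: norm_mult\<close>)
    have pointwise: "norm (c - y) powr q / (2*pi) \<le>
        2 powr q * (norm c powr q / (2*pi) + norm y powr q / (2*pi))" for y
    proof -
      have "norm (c - y) \<le> 2 * max (norm c) (norm y)"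
        using norm_triangle_ineq4[of c y] by linarith
      then have "norm (c - y) powr q \<le> (2 * max (norm c) (norm y)) powr q"
        using \<open>0 < q\<close> by (intro powr_mono2) auto
      also have "\<dots> = 2 powr q * max (norm c) (norm y) powr q"
        by (simp add: powr_mult)
      also have "max (norm c) (norm y) powr q \<le> norm c powr q + norm y powr q"
        by (simp add: max_def)
      finally have "norm (c - y) powr q / (2*pi) \<le>
          2 powr q * (norm c powr q + norm y powr q) / (2*pi)"
        by (simp add: divide_right_mono)
      then show ?thesis
        by (simp only: add_divide_distrib[symmetric] times_divide_eq_right)
    qed
    have intL: "(\<lambda>\<theta>. norm (L (of_real r * cis \<theta>)) powr q / (2*pi)) integrable_on {0..2*pi}"
      using \<open>0 < q\<close> by (intro integrable_continuous_interval continuous_intros continuous_on_powr' cont) auto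
    have "integral {0..2*pi} (\<lambda>\<theta>. norm (c - L (of_real r * cis \<theta>)) powr q / (2*pi)) \<le>
        integral {0..2*pi} (\<lambda>\<theta>. 2 powr q * (norm c powr q / (2*pi) +
          norm (L (of_real r * cis \<theta>)) powr q / (2*pi)))"
      using \<open>0 < q\<close>
      by (intro integral_le integrable_continuous_interval continuous_intros continuous_on_powr' cont
            pointwise) auto
    also have "\<dots> = 2 powr q * (norm c powr q +
        integral {0..2*pi} (\<lambda>\<theta>. norm (L (of_real r * cis \<theta>)) powr q / (2*pi)))"
      by (subst integral_mult_right, subst integral_add[OF integrable_const_ivl intL]) simp
    also have "\<dots> \<le> 2 powr q * (norm c powr q + A)"
      using mean[OF r] by simp
    finally show ?thesis .
  qed
  then show ?thesis
    using holo unfolding hardy_space_def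
    by (auto intro!: holomorphic_intros bdd_aboveI2)
qed

text \<open>The principal logarithm is holomorphic on the right half-plane, so \<open>h\<close> has a global
  \<open>q\<close>-th power, and \<open>q\<close>-th means of \<open>h\<close> become first means of this power.\<close>

lemma hardy_space_power_right_half_plane:
  assumes h: "h \<in> hardy_space q" and pos: "\<And>w. w \<in> unit_disc \<Longrightarrow> 0 < Re (h w)"
  obtains G where "G \<in> hardy_space 1" "\<And>w. w \<in> unit_disc \<Longrightarrow> norm (G w) = norm (h w) powr q"
proof
  let ?G = "\<lambda>w. exp (of_real q * Ln (h w))"
  show G: "norm (?G w) = norm (h w) powr q" if "w \<in> unit_disc" for w
    using pos[OF that] by (auto simp: powr_def)
  have holo: "?G holomorphic_on unit_disc"
    using h by (intro holomorphic_intros)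
      (auto simp: hardy_space_def complex_nonpos_Reals_iff not_le intro: pos)
  have "integral {0..2*pi} (\<lambda>\<theta>. norm (?G (of_real r * cis \<theta>)) powr 1 / (2*pi)) =
      integral {0..2*pi} (\<lambda>\<theta>. norm (h (of_real r * cis \<theta>)) powr q / (2*pi))"
    if "r \<in> {0<..<1}" for r
    using that by (intro integral_cong) (subst G, auto simp: norm_mult)
  then show "?G \<in> hardy_space 1"
    using h holo unfolding hardy_space_def mem_Collect_eq by (metis (no_types, lifting) image_cong)
qed

section \<open>The logarithm of the size of the generators\<close>

text \<open>Boundedness of the generators gives an upper bound for \<open>\<Sum> \<bar>f\<^sub>i\<bar>\<close>, and boundedness of the
  coefficients of \<open>F\<close> gives the lower bound \<open>exp (Re L) / B\<close>, where \<open>B\<close> bounds them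
  all. Together they also bound
  \<open>Re L\<close> from above, which is what allows \<open>L\<close> to be moved into a half-plane.\<close>

lemma abs_ln_sum_norm_le:
  assumes f: "\<And>i. i \<in> {1..n} \<Longrightarrow> f i \<in> Hinf" and F: "F \<in> Hinf_ideal n f"
    and L: "log_branch F L"
  obtains C where "0 \<le> C" "\<And>w. w \<in> unit_disc \<Longrightarrow> Re (L w) \<le> C"
    "\<And>w. w \<in> unit_disc \<Longrightarrow> \<bar>ln (\<Sum>i=1..n. norm (f i w))\<bar> \<le> C + norm (L w)"
proof -
  obtain g where g: "\<And>i. i \<in> {1..n} \<Longrightarrow> g i \<in> Hinf"
      and F_eq: "\<And>w. w \<in> unit_disc \<Longrightarrow> F w = (\<Sum>i=1..n. g i w * f i w)"
    using F unfolding Hinf_ideal_def by blast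
  have "bounded (\<Union>i\<in>{1..n}. f i ` unit_disc \<union> g i ` unit_disc)"
    using f g by (intro bounded_UN) (auto simp: Hinf_def)
  then obtain B where "0 < B"
      and "\<forall>x\<in>\<Union>i\<in>{1..n}. f i ` unit_disc \<union> g i ` unit_disc. norm x \<le> B"
    unfolding bounded_pos by (elim exE conjE)
  then have B: "norm (f i w) \<le> B \<and> norm (g i w) \<le> B" if "i \<in> {1..n}" "w \<in> unit_disc" for i w
    using that unfolding ball_UN ball_Un ball_simps by simp
  let ?s = "\<lambda>w. \<Sum>i=1..n. norm (f i w)"
  have lower: "exp (Re (L w)) \<le> B * ?s w" if w: "w \<in> unit_disc" for w
  proof -
    have "exp (Re (L w)) = norm (\<Sum>i=1..n. g i w * f i w)"
      using L w F_eq[OF w] by (auto simp: log_branch_def simp flip: norm_exp_eq_Re)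
    also have "\<dots> \<le> (\<Sum>i=1..n. B * norm (f i w))"
      using B w by (intro sum_norm_le) (auto simp: norm_mult intro!: mult_right_mono)
    finally show ?thesis
      by (simp add: sum_distrib_left)
  qed
  have s_pos: "0 < ?s w" if "w \<in> unit_disc" for w
    using less_le_trans[OF exp_gt_zero lower[OF that]] \<open>0 < B\<close> by (simp add: zero_less_mult_iff)
  have ln_lower: "Re (L w) \<le> ln B + ln (?s w)" if "w \<in> unit_disc" for w
    using lower[OF that] s_pos[OF that] \<open>0 < B\<close> by (simp add: ln_mult flip: ln_ge_iff)
  have ln_upper: "ln (?s w) \<le> ln (n * B)" if w: "w \<in> unit_disc" for w
  proof -
    have "?s w \<le> n * B"
      using B w sum_bounded_above[of "{1..n}" "\<lambda>i. norm (f i w)" B] by auto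
    then show ?thesis
      using s_pos[OF w] by simp
  qed
  show ?thesis
  proof
    fix w assume w: "w \<in> unit_disc"
    show "Re (L w) \<le> \<bar>ln B\<bar> + \<bar>ln (n * B)\<bar>"
      using ln_lower[OF w] ln_upper[OF w] by linarith
    show "\<bar>ln (?s w)\<bar> \<le> (\<bar>ln B\<bar> + \<bar>ln (n * B)\<bar>) + norm (L w)"
      using ln_lower[OF w] ln_upper[OF w] abs_Re_le_cmod[of "L w"] by linarith
  qed auto
qed

theorem theorem6:
  fixes q :: real and n :: nat
    and f :: "nat \<Rightarrow> complex \<Rightarrow> complex" and z :: "nat \<Rightarrow> complex"
  assumes "0 < q"
    and "\<And>i. i \<in> {1..n} \<Longrightarrow> f i \<in> Hinf"
    and "\<exists>F\<in>Hinf_ideal n f. F holomorphic_on unit_disc \<and> (\<forall>w\<in>unit_disc. F w \<noteq> 0) \<and>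
           (\<exists>L. log_branch F L \<and> L \<in> hardy_space q)"
    and "interpolating_sequence z"
  shows "summable (\<lambda>k. (1 - norm (z k) ^ 2) * \<bar>ln (\<Sum>i=1..n. norm (f i (z k)))\<bar> powr q)"
proof -
  obtain F L where F: "F \<in> Hinf_ideal n f" "log_branch F L" and L: "L \<in> hardy_space q"
    using assms(3) by blast
  obtain C where "0 \<le> C" and ReL: "\<And>w. w \<in> unit_disc \<Longrightarrow> Re (L w) \<le> C"
    and ln_le: "\<And>w. w \<in> unit_disc \<Longrightarrow> \<bar>ln (\<Sum>i=1..n. norm (f i w))\<bar> \<le> C + norm (L w)"
    using abs_ln_sum_norm_le[OF assms(2) F] by blast
  \<comment> \<open>The shift by \<open>C + 1\<close> puts \<open>h\<close> into the half-plane \<open>Re \<ge> 1\<close>, so that \<open>h\<close> has a holomorphic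
    \<open>q\<close>-th power and its modulus dominates constants.\<close>
  define h where "h w = of_real (C + 1) - L w" for w
  have "h \<in> hardy_space q"
    unfolding h_def using hardy_space_const_minus[OF assms(1) L] .
  moreover have Re_h: "1 \<le> Re (h w)" if "w \<in> unit_disc" for w
    using ReL[OF that] by (simp add: h_def)
  ultimately obtain G where "G \<in> hardy_space 1"
    and G: "\<And>w. w \<in> unit_disc \<Longrightarrow> norm (G w) = norm (h w) powr q"
    using hardy_space_power_right_half_plane by (metis less_le_trans zero_less_one)
  have ln_le_h: "\<bar>ln (\<Sum>i=1..n. norm (f i w))\<bar> \<le> (2 * C + 2) * norm (h w)"
    if w: "w \<in> unit_disc" for w
  proof -
    have "norm (L w) \<le> (C + 1) + norm (h w)"
      using norm_triangle_ineq4[of "of_real (C + 1)" "h w"] \<open>0 \<le> C\<close>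
      by (simp add: h_def del: of_real_add)
    moreover have h1: "1 \<le> norm (h w)"
      using Re_h[OF w] complex_Re_le_cmod[of "h w"] by linarith
    moreover have "(2 * C + 1) * 1 \<le> (2 * C + 1) * norm (h w)"
      using h1 \<open>0 \<le> C\<close> by (intro mult_left_mono) auto
    ultimately show ?thesis
      using ln_le[OF w] by (simp add: algebra_simps)
  qed
  have disc: "z k \<in> unit_disc" for k
    using assms(4) by (simp add: interpolating_sequence_def)
  have "summable (\<lambda>k. (2 * C + 2) powr q * ((1 - norm (z k) ^ 2) * norm (G (z k))))"
    using interpolating_sequence_carleson_embedding[OF assms(4) \<open>G \<in> hardy_space 1\<close>]
    by (rule summable_mult)
  then show ?thesis
  proof (rule summable_comparison_test'[where N = 0])
    fix k
    have weight: "0 \<le> 1 - norm (z k) ^ 2"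
      using disc[of k] by (simp add: power_le_one)
    have "\<bar>ln (\<Sum>i=1..n. norm (f i (z k)))\<bar> powr q \<le> ((2 * C + 2) * norm (h (z k))) powr q"
      using ln_le_h[OF disc] assms(1) by (intro powr_mono2) auto
    also have "\<dots> = (2 * C + 2) powr q * norm (G (z k))"
      using \<open>0 \<le> C\<close> by (simp add: G[OF disc] powr_mult)
    finally show "norm ((1 - norm (z k) ^ 2) * \<bar>ln (\<Sum>i=1..n. norm (f i (z k)))\<bar> powr q) \<le>
        (2 * C + 2) powr q * ((1 - norm (z k) ^ 2) * norm (G (z k)))"
      using mult_left_mono[OF _ weight] weight by (simp add: abs_mult mult.left_commute)
  qed
qed

end
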